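(* For every integer $k \geq 2$ and every natural number $n \geq 4k-3$, there exists a $D(k)$ graph of order $n$ (i.e. with exactly $n$ vertices). Equivalently, the class $\mathcal{D}(k,n)$ of $D(k)$ graphs of order $n$ is nonempty.
   Context: All graphs are finite, simple and connected. $\gamma(G)$ denotes the domination number and $\chi(G)$ the chromatic number of $G$. A (proper) coloring of $G$ with $k$ colors is a partition $C=(V_1,\dots,V_k)$ of $V(G)$ into nonempty independent sets, called color classes. A vertex $u$ dominates the color class $V_i$ if $u$ is adjacent to every vertex of $V_i$, or if $V_i=\{u\}$. A dominator coloring of $G$ is a coloring in which every vertex dominates at least one color class; the dominator chromatic number $\chi_d(G)$ is the minimum number of colors in a dominator coloring of $G$. A graph $G$ is called a $D(k)$ graph if $\gamma(G)=\chi(G)=\chi_d(G)=k$. *)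

theory Defs
  imports "Graph_Theory.Graph_Theory" "HOL-Library.Disjoint_Sets"
begin

text \<open>
  A finite simple graph is a \<^term>\<open>pair_graph\<close>: a finite loopless digraph with a symmetric arc
  set, so that \<^prop>\<open>(u, v) \<in> parcs G\<close> says that u and v are adjacent.
  All the minima below are over nonempty sets of naturals when the graph is finite and loopless
  (take the whole vertex set, respectively the partition into singletons), and the vertex sets and
  colorings being counted are then finite.
\<close>

definition dominating_set :: "'a pair_pre_digraph \<Rightarrow> 'a set \<Rightarrow> bool" where
  "dominating_set G S \<longleftrightarrow>
     S \<subseteq> pverts G \<and> (\<forall>v \<in> pverts G - S. \<exists>u \<in> S. (u, v) \<in> parcs G)"

definition domination_number :: "'a pair_pre_digraph \<Rightarrow> nat" where
  "domination_number G = (LEAST m. \<exists>S. dominating_set G S \<and> card S = m)"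

definition independent_set :: "'a pair_pre_digraph \<Rightarrow> 'a set \<Rightarrow> bool" where
  "independent_set G S \<longleftrightarrow> S \<subseteq> pverts G \<and> (\<forall>u \<in> S. \<forall>v \<in> S. (u, v) \<notin> parcs G)"

text \<open>
  A coloring is the set of its color classes. Nonemptiness of the classes is part of
  \<^const>\<open>partition_on\<close>; the number of colors is \<^term>\<open>card C\<close>.
\<close>

definition proper_coloring :: "'a pair_pre_digraph \<Rightarrow> 'a set set \<Rightarrow> bool" where
  "proper_coloring G C \<longleftrightarrow> partition_on (pverts G) C \<and> (\<forall>V \<in> C. independent_set G V)"

definition chromatic_number :: "'a pair_pre_digraph \<Rightarrow> nat" where
  "chromatic_number G = (LEAST m. \<exists>C. proper_coloring G C \<and> card C = m)"

definition dominates_class :: "'a pair_pre_digraph \<Rightarrow> 'a \<Rightarrow> 'a set \<Rightarrow> bool" where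
  "dominates_class G u V \<longleftrightarrow> (\<forall>v \<in> V. (u, v) \<in> parcs G) \<or> V = {u}"

definition dominator_coloring :: "'a pair_pre_digraph \<Rightarrow> 'a set set \<Rightarrow> bool" where
  "dominator_coloring G C \<longleftrightarrow>
     proper_coloring G C \<and> (\<forall>u \<in> pverts G. \<exists>V \<in> C. dominates_class G u V)"

definition dominator_chromatic_number :: "'a pair_pre_digraph \<Rightarrow> nat" where
  "dominator_chromatic_number G = (LEAST m. \<exists>C. dominator_coloring G C \<and> card C = m)"

definition D_graph :: "nat \<Rightarrow> 'a pair_pre_digraph \<Rightarrow> bool" where
  "D_graph k G \<longleftrightarrow>
     pair_graph G \<and> connected (with_proj G) \<and>
     domination_number G = k \<and> chromatic_number G = k \<and> dominator_chromatic_number G = k"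

end

theory Submission
  imports Defs
begin

text \<open>
  Take \<open>k div 2\<close> bipartite blocks, the sides being the colour classes.  Every side contains two
  vertices with neighbours in their own block only, which forces a dominating set to spend two
  vertices on each block, and (unless \<open>k = 2\<close>) a hub; the hubs form a clique.  If \<open>k\<close> is even, the
  blocks are complete bipartite.  If \<open>k\<close> is odd, there is an extra vertex \<open>w\<close>, joined to the hubs and
  to one further vertex per side.  A dominating set that avoids \<open>w\<close> and spends exactly two vertices
  on each block consists, in every block where it meets the neighbours of \<open>w\<close>, of the two non-hub
  neighbours of \<open>w\<close>; then the hubs of that block stay undominated.  Larger orders are obtained by
  replacing one vertex by several twins.
\<close>

section \<open>Dominating cliques\<close>

text \<open>Two distinct clique vertices are adjacent, so no independent class holds both; choosing
  a class for each clique vertex is therefore injective.\<close>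

lemma clique_card_le_coloring:
  assumes "finite (pverts G)" "K \<subseteq> pverts G"
    and clique: "\<And>u v. u \<in> K \<Longrightarrow> v \<in> K \<Longrightarrow> u \<noteq> v \<Longrightarrow> (u, v) \<in> parcs G"
    and D: "proper_coloring G D"
  shows "card K \<le> card D"
proof -
  have part: "partition_on (pverts G) D" and ind: "\<And>A. A \<in> D \<Longrightarrow> independent_set G A"
    using D by (auto simp: proper_coloring_def)
  then have "\<forall>v \<in> K. \<exists>A \<in> D. v \<in> A"
    using assms(2) by (auto simp: partition_on_def)
  then obtain g where g: "\<And>v. v \<in> K \<Longrightarrow> g v \<in> D \<and> v \<in> g v"
    by metis
  have "inj_on g K"
    using g ind clique unfolding inj_on_def independent_set_def by metis
  moreover have "finite D"
    using finite_elements[OF assms(1) part] .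
  ultimately show ?thesis
    using g by (intro card_inj_on_le[of g]) auto
qed

text \<open>Each vertex lies in \<open>K\<close> or is one arc away from it, and inside
  \<open>K\<close> any two vertices are joined directly.\<close>

lemma connected_if_dominating_clique:
  assumes "pair_graph G" and dom: "dominating_set G K" and "K \<noteq> {}"
    and clique: "\<And>u v. u \<in> K \<Longrightarrow> v \<in> K \<Longrightarrow> u \<noteq> v \<Longrightarrow> (u, v) \<in> parcs G"
  shows "connected (with_proj G)"
proof -
  interpret pair_graph G by fact
  have K: "K \<subseteq> pverts G"
    using dom by (simp add: dominating_set_def)
  have sym: "(u, v) \<in> parcs G \<Longrightarrow> (v, u) \<in> parcs G" for u v
    using pair_sym_arcs by (auto simp: symmetric_def sym_def)
  have near: "\<exists>a \<in> K. u \<rightarrow>\<^sup>*\<^bsub>with_proj G\<^esub> a \<and> a \<rightarrow>\<^sup>*\<^bsub>with_proj G\<^esub> u" if u: "u \<in> pverts G" for u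
  proof (cases "u \<in> K")
    case True
    then show ?thesis using u by auto
  next
    case False
    then obtain a where "a \<in> K" "(a, u) \<in> parcs G"
      using dom u by (auto simp: dominating_set_def)
    then show ?thesis
      using sym by auto
  qed
  have K_reach: "a \<rightarrow>\<^sup>*\<^bsub>with_proj G\<^esub> b" if "a \<in> K" "b \<in> K" for a b
    using clique[OF that] K that by (cases "a = b") auto
  have "u \<rightarrow>\<^sup>*\<^bsub>with_proj G\<^esub> v" if "u \<in> pverts G" "v \<in> pverts G" for u v
    using near[OF that(1)] near[OF that(2)] K_reach by (meson reachable_trans)
  then show ?thesis
    using K \<open>K \<noteq> {}\<close> reachable_mk_symmetric_eq[OF pair_sym_arcs]
    unfolding connected_def by (intro strongly_connectedI) auto
qed

text \<open>One dominating clique of size \<open>k\<close> gives connectedness, the upper bound for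
  the domination number and the lower bounds for both chromatic numbers; \<open>C\<close> supplies
  the upper bounds for the latter. Thus \<open>lower\<close> is the only extremal estimate left for
  a concrete graph.\<close>

lemma D_graphI:
  assumes G: "pair_graph G" and dom: "dominating_set G K" and "card K = k" "k > 0"
    and clique: "\<And>u v. u \<in> K \<Longrightarrow> v \<in> K \<Longrightarrow> u \<noteq> v \<Longrightarrow> (u, v) \<in> parcs G"
    and lower: "\<And>S. dominating_set G S \<Longrightarrow> k \<le> card S"
    and C: "dominator_coloring G C" "card C \<le> k"
  shows "D_graph k G"
proof -
  interpret pair_graph G by fact
  have proper: "k \<le> card D" if "proper_coloring G D" for D
    using clique_card_le_coloring[OF _ _ clique that] dom \<open>card K = k\<close>
    by (auto simp: dominating_set_def)
  have C': "proper_coloring G C" "card C = k"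
    using C proper[of C] by (auto simp: dominator_coloring_def)
  have "K \<noteq> {}"
    using \<open>card K = k\<close> \<open>k > 0\<close> by auto
  then have "connected (with_proj G)"
    by (rule connected_if_dominating_clique[OF G dom _ clique])
  moreover have "domination_number G = k"
    unfolding domination_number_def using dom \<open>card K = k\<close> lower
    by (intro Least_equality) auto
  moreover have "chromatic_number G = k"
    unfolding chromatic_number_def using C' proper by (intro Least_equality) auto
  moreover have "dominator_chromatic_number G = k"
    unfolding dominator_chromatic_number_def using C C' proper
    by (intro Least_equality) (auto simp: dominator_coloring_def)
  ultimately show ?thesis
    using G by (simp add: D_graph_def)
qed

section \<open>Pulling back a graph along a labelling of the vertices\<close>

text \<open>For irreflexive \<open>E\<close>, vertices with equal labels are nonadjacent twins, so a
  fixed finite graph on labels can be inflated to any larger order.\<close>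

definition pullback :: "'a set \<Rightarrow> ('a \<Rightarrow> 'b) \<Rightarrow> ('b \<Rightarrow> 'b \<Rightarrow> bool) \<Rightarrow> 'a pair_pre_digraph" where
  "pullback V f E = \<lparr>pverts = V, parcs = {(u, v). u \<in> V \<and> v \<in> V \<and> E (f u) (f v)}\<rparr>"

lemma pullback_simps [simp]:
  "pverts (pullback V f E) = V"
  "(u, v) \<in> parcs (pullback V f E) \<longleftrightarrow> u \<in> V \<and> v \<in> V \<and> E (f u) (f v)"
  by (auto simp: pullback_def)

lemma pair_graph_pullback:
  assumes "finite V" and sym: "\<And>x y. E x y \<Longrightarrow> E y x" and irrefl: "\<And>x. \<not> E x x"
  shows "pair_graph (pullback V f E)"
proof unfold_locales
  show "finite (parcs (pullback V f E))"
    by (rule finite_subset[of _ "V \<times> V"]) (use assms(1) in \<open>auto simp: pullback_def\<close>)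
qed (use assms in \<open>auto simp: pullback_def symmetric_def sym_def\<close>)

text \<open>Moves the criterion from vertices to labels: the image of a dominating set dominates the
  labels and is no larger. The condition \<open>class_dom\<close> still speaks of vertices, because
  a class with a single label may contain several twins.\<close>

lemma D_graph_pullback:
  fixes f :: "'a \<Rightarrow> 'b" and c :: "'b \<Rightarrow> 'c"
  assumes "finite V" and sym: "\<And>x y. E x y \<Longrightarrow> E y x"
    and proper: "\<And>x y. E x y \<Longrightarrow> c x \<noteq> c y" and colors: "card (c ` f ` V) \<le> k"
    and K: "K \<subseteq> f ` V" "card K = k" "k > 0"
    and clique: "\<And>x y. x \<in> K \<Longrightarrow> y \<in> K \<Longrightarrow> x \<noteq> y \<Longrightarrow> E x y"
    and K_dom: "\<And>x. x \<in> f ` V \<Longrightarrow> \<exists>y \<in> K. E y x"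
    and lower: "\<And>S. S \<subseteq> f ` V \<Longrightarrow> \<forall>x \<in> f ` V - S. \<exists>y \<in> S. E y x \<Longrightarrow> k \<le> card S"
    and class_dom: "\<And>v. v \<in> V \<Longrightarrow> (\<exists>j \<in> c ` f ` V. \<forall>w \<in> V. c (f w) = j \<longrightarrow> E (f v) (f w)) \<or>
      (\<forall>w \<in> V. c (f w) = c (f v) \<longrightarrow> w = v)"
  shows "D_graph k (pullback V f E)"
proof -
  let ?G = "pullback V f E"
  obtain K' where K': "K' \<subseteq> V" "inj_on f K'" "K = f ` K'"
    using K(1) unfolding subset_image_inj by blast
  define cls where "cls j = {v \<in> V. c (f v) = j}" for j
  let ?C = "cls ` c ` f ` V"
  show ?thesis
  proof (rule D_graphI)
    show "pair_graph ?G"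
      using proper sym \<open>finite V\<close> by (intro pair_graph_pullback) blast+
    \<comment> \<open>\<open>K'\<close> has only one vertex per label, and its twins are not
      adjacent to it. This is why \<open>K_dom\<close> asks for a neighbour in \<open>K\<close> even
      for the labels of \<open>K\<close> itself.\<close>
    show "dominating_set ?G K'"
      unfolding dominating_set_def using K_dom K' by fastforce
    show "card K' = k" "k > 0"
      using K K' by (auto simp: card_image)
    show "(u, v) \<in> parcs ?G" if "u \<in> K'" "v \<in> K'" "u \<noteq> v" for u v
      using that clique[of "f u" "f v"] K' by (auto dest: inj_onD)
    show "k \<le> card S" if "dominating_set ?G S" for S
    proof -
      have S: "S \<subseteq> V" "\<forall>v \<in> V - S. \<exists>u \<in> S. E (f u) (f v)"
        using that by (auto simp: dominating_set_def)
      then have "k \<le> card (f ` S)"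
        by (intro lower) auto
      also have "\<dots> \<le> card S"
        using S(1) \<open>finite V\<close> by (intro card_image_le) (rule finite_subset)
      finally show ?thesis .
    qed
    show "card ?C \<le> k"
      using colors card_image_le[of "c ` f ` V" cls] \<open>finite V\<close> by simp
    have "partition_on V ?C"
      by (auto simp: partition_on_def disjoint_def cls_def)
    moreover have "independent_set ?G A" if "A \<in> ?C" for A
      using that by (auto simp: independent_set_def cls_def dest: proper)
    moreover have "\<exists>A \<in> ?C. dominates_class ?G v A" if "v \<in> V" for v
      using class_dom[OF that]
    proof
      assume "\<exists>j \<in> c ` f ` V. \<forall>w \<in> V. c (f w) = j \<longrightarrow> E (f v) (f w)"
      then show ?thesis
        using that by (auto simp: dominates_class_def cls_def)
    next
      assume "\<forall>w \<in> V. c (f w) = c (f v) \<longrightarrow> w = v"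
      then have "cls (c (f v)) = {v}"
        using that by (auto simp: cls_def)
      then show ?thesis
        using that by (auto simp: dominates_class_def)
    qed
    ultimately show "dominator_coloring ?G ?C"
      by (simp add: dominator_coloring_def proper_coloring_def)
  qed
qed

text \<open>All surplus vertices receive the label \<open>l\<close>, so only \<open>l\<close>
  acquires twins.\<close>

lemma exists_labelling:
  assumes "finite L" "l \<in> L" "card L \<le> n"
  shows "\<exists>f :: nat \<Rightarrow> 'a. f ` {..<n} = L \<and> (\<forall>u v. f u = f v \<and> f u \<noteq> l \<longrightarrow> u = v)"
proof -
  obtain h where h: "bij_betw h {..<card L} L"
    using ex_bij_betw_nat_finite[OF assms(1)] by (auto simp: atLeast0LessThan)
  define f where "f i = (if i < card L then h i else l)" for i
  have "f ` {..<n} = L"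
  proof
    show "f ` {..<n} \<subseteq> L"
      using h assms(2) by (auto simp: f_def bij_betw_def)
    have "L = f ` {..<card L}"
      using h by (auto simp: f_def bij_betw_def)
    also have "\<dots> \<subseteq> f ` {..<n}"
      using assms(3) by (intro image_mono) auto
    finally show "L \<subseteq> f ` {..<n}" .
  qed
  moreover have "u = v" if "f u = f v" "f u \<noteq> l" for u v
    using that h by (auto simp: f_def bij_betw_def inj_on_def split: if_splits)
  ultimately show ?thesis
    by blast
qed

section \<open>The block graph\<close>

text \<open>
  \<^term>\<open>Some (i, s, t)\<close> lies on side \<open>s\<close> of block \<open>i\<close>, and \<^term>\<open>None\<close> is the vertex \<open>w\<close>.  The kind
  \<open>t\<close> is 0 for the hub, 1 for the other neighbour of \<open>w\<close>, and 2 or 3 for the vertices that have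
  neighbours in their own block only.
\<close>

type_synonym label = "(nat \<times> bool \<times> nat) option"

text \<open>Opposite sides of a block are completely joined except for the kind pairs (0,1), (1,0)
  and (1,1). These gaps prevent kind 1 vertices from dominating hubs or each other.\<close>

fun adj :: "label \<Rightarrow> label \<Rightarrow> bool" where
  "adj None None \<longleftrightarrow> False"
| "adj None (Some (j, s', t')) \<longleftrightarrow> t' < 2"
| "adj (Some (i, s, t)) None \<longleftrightarrow> t < 2"
| "adj (Some (i, s, t)) (Some (j, s', t')) \<longleftrightarrow>
     (if i = j then s \<noteq> s' \<and> (t \<ge> 2 \<or> t' \<ge> 2 \<or> t = 0 \<and> t' = 0) else t = 0 \<and> t' = 0)"

definition side :: "label \<Rightarrow> (nat \<times> bool) option" where
  "side = map_option (\<lambda>(i, s, t). (i, s))"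

lemma side_simps [simp]: "side None = None" "side (Some (i, s, t)) = Some (i, s)"
  by (simp_all add: side_def)

lemma adj_sym: "adj x y \<Longrightarrow> adj y x"
  by (induction x y rule: adj.induct) (auto split: if_splits)

lemma adj_side: "adj x y \<Longrightarrow> side x \<noteq> side y"
  by (induction x y rule: adj.induct) auto

text \<open>\<open>T\<close> is the set of kinds in use: \<open>{2, 3}\<close> for
  \<open>k = 2\<close>, \<open>{0, 2, 3}\<close> for larger even \<open>k\<close>, and
  \<open>{0, 1, 2, 3}\<close> for odd \<open>k\<close>.\<close>

definition blocks :: "nat \<Rightarrow> nat set \<Rightarrow> label set" where
  "blocks r T = Some ` ({..<r} \<times> UNIV \<times> T)"

lemma Some_in_blocks [simp]: "Some (i, s, t) \<in> blocks r T \<longleftrightarrow> i < r \<and> t \<in> T"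
  by (auto simp: blocks_def)

lemma None_notin_blocks [simp]: "None \<notin> blocks r T"
  by (auto simp: blocks_def)

lemma finite_blocks [simp]: "finite T \<Longrightarrow> finite (blocks r T)"
  by (simp add: blocks_def)

lemma card_blocks [simp]: "card (blocks r T) = 2 * r * card T"
  by (simp add: blocks_def card_image card_cartesian_product)

lemma side_blocks: "side ` blocks r T \<subseteq> Some ` ({..<r} \<times> UNIV)"
  by (auto simp: blocks_def)

lemma card_sides: "card (Some ` ({..<r} \<times> (UNIV :: bool set))) = 2 * r"
  by (simp add: card_image card_cartesian_product)

section \<open>Lower bounds for dominating sets, counted block by block\<close>

definition block :: "label set \<Rightarrow> nat \<Rightarrow> label set" where
  "block S i = {x \<in> S. \<exists>s t. x = Some (i, s, t)}"

lemma Some_in_block [simp]: "Some (j, s, t) \<in> block S i \<longleftrightarrow> j = i \<and> Some (i, s, t) \<in> S"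
  by (auto simp: block_def)

lemma finite_block [simp]: "finite S \<Longrightarrow> finite (block S i)"
  by (simp add: block_def)

lemma sum_card_block_le:
  assumes "finite S"
  shows "(\<Sum>i<r. card (block S i)) \<le> card (S - {None})"
proof -
  have "(\<Sum>i<r. card (block S i)) = card (\<Union>i<r. block S i)"
    using assms by (subst card_UN_disjoint) (auto simp: block_def)
  also have "\<dots> \<le> card (S - {None})"
    using assms by (intro card_mono) (auto simp: block_def)
  finally show ?thesis .
qed

text \<open>All neighbours of a vertex of kind 2 or 3 lie on the opposite side of its block. If
  \<open>S\<close> misses that side, both such vertices must belong to \<open>S\<close>
  themselves.\<close>

lemma opposite_side_or_private_pair:
  assumes dom: "\<forall>x \<in> L - S. \<exists>y \<in> S. adj y x" and "blocks r T \<subseteq> L" "{2, 3} \<subseteq> T" "i < r"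
  shows "(\<exists>t. Some (i, \<not> s, t) \<in> S) \<or> Some (i, s, 2) \<in> S \<and> Some (i, s, 3) \<in> S"
proof -
  have "Some (i, s, t) \<in> S \<or> (\<exists>t. Some (i, \<not> s, t) \<in> S)" if "t \<in> {2, 3}" for t
  proof (rule ccontr)
    assume neg: "\<not> ?thesis"
    have "Some (i, s, t) \<in> L"
      using assms(2-4) that by (auto intro!: subsetD[OF assms(2)])
    then obtain y where y: "y \<in> S" "adj y (Some (i, s, t))"
      using dom neg by blast
    then show False
      using neg that by (cases y) (auto split: if_splits)
  qed
  from this[of 2] this[of 3] show ?thesis
    by auto
qed

text \<open>Either some side has both private vertices in \<open>S\<close>, or \<open>S\<close>
  meets both sides.\<close>

lemma two_le_card_block:
  assumes dom: "\<forall>x \<in> L - S. \<exists>y \<in> S. adj y x" and "blocks r T \<subseteq> L" "{2, 3} \<subseteq> T" "i < r"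
    and "finite S"
  shows "2 \<le> card (block S i)"
proof -
  note opp = opposite_side_or_private_pair[OF assms(1-4)]
  obtain x y where "x \<noteq> y" "{x, y} \<subseteq> block S i"
  proof (cases "\<exists>s. Some (i, s, 2) \<in> S \<and> Some (i, s, 3) \<in> S")
    case True
    then obtain s where "Some (i, s, 2) \<in> S" "Some (i, s, 3) \<in> S"
      by blast
    then show ?thesis
      using that[of "Some (i, s, 2)" "Some (i, s, 3)"] by simp
  next
    case False
    then obtain t t' where "Some (i, False, t) \<in> S" "Some (i, True, t') \<in> S"
      using opp[of True] opp[of False] by auto
    then show ?thesis
      using that[of "Some (i, False, t)" "Some (i, True, t')"] by simp
  qed
  then show ?thesis
    using card_mono[of "block S i" "{x, y}"] \<open>finite S\<close> by simp
qed

lemma card_dominating_ge: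
  assumes dom: "\<forall>x \<in> L - S. \<exists>y \<in> S. adj y x" and "blocks r T \<subseteq> L" "{2, 3} \<subseteq> T" "finite S"
  shows "2 * r \<le> card (S - {None})"
proof -
  have "2 * r \<le> (\<Sum>i<r. card (block S i))"
    using sum_bounded_below[of "{..<r}" 2 "\<lambda>i. card (block S i)"]
      two_le_card_block[OF assms(1-3) _ assms(4)] by (simp add: mult.commute)
  also have "\<dots> \<le> card (S - {None})"
    by (rule sum_card_block_le) fact
  finally show ?thesis .
qed

text \<open>Without \<open>w\<close>, a kind 1 vertex outside \<open>S\<close> needs a vertex of
  kind at least 2 across from it. With only two vertices available, this forces kind 1 on each side
  in turn.\<close>

lemma block_eq_kind_one_pair:
  assumes dom: "\<forall>x \<in> L - S. \<exists>y \<in> S. adj y x" and L: "blocks r {0, 1, 2, 3} \<subseteq> L"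
    and "finite S" "None \<notin> S" "i < r" and two: "card (block S i) = 2"
    and x: "Some (i, s, t) \<in> S" "t < 2"
  shows "block S i = {Some (i, s, 1), Some (i, \<not> s, 1)}"
proof -
  have three: False if "x \<in> block S i" "y \<in> block S i" "z \<in> block S i" "x \<noteq> y" "y \<noteq> z" "x \<noteq> z"
    for x y z
  proof -
    have "card {x, y, z} \<le> card (block S i)"
      using that \<open>finite S\<close> by (intro card_mono) auto
    then show False
      using that two by simp
  qed
  \<comment> \<open>If \<open>S\<close> missed the opposite side, the private pair on side
    \<open>s\<close> would join the given vertex, which makes three.\<close>
  obtain t' where y: "Some (i, \<not> s, t') \<in> S"
    using opposite_side_or_private_pair[OF dom L _ \<open>i < r\<close>, of s] x
      three[of "Some (i, s, t)" "Some (i, s, 2)" "Some (i, s, 3)"] by auto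
  have eq: "block S i = {Some (i, s, t), Some (i, \<not> s, t')}"
    using x(1) y three[of "Some (i, s, t)" "Some (i, \<not> s, t')"] by fastforce
  \<comment> \<open>The only vertex on side \<open>b\<close> has kind \<open>a' < 2\<close>, so it
    cannot dominate the kind 1 vertex opposite; that vertex must be in \<open>S\<close>.\<close>
  have one: "a = 1" if "block S i = {Some (i, b, a'), Some (i, \<not> b, a)}" "a' < 2" for a a' b
  proof (rule ccontr)
    assume "a \<noteq> 1"
    then have "Some (i, \<not> b, 1) \<notin> block S i"
      using that by auto
    then have "Some (i, \<not> b, 1) \<notin> S"
      by simp
    moreover have "Some (i, \<not> b, 1) \<in> L"
      using \<open>i < r\<close> by (auto intro!: subsetD[OF L])
    ultimately obtain z where z: "z \<in> S" "adj z (Some (i, \<not> b, 1))"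
      using dom by blast
    then obtain c where c: "z = Some (i, b, c)" "c \<ge> 2"
      using \<open>None \<notin> S\<close> by (cases z) (auto split: if_splits)
    then have "z \<in> block S i"
      using z by simp
    then show False
      using c that by auto
  qed
  have "t' = 1"
    using one[OF eq x(2)] .
  \<comment> \<open>The same argument with the sides exchanged; it applies because
    \<open>t' = 1\<close> is below 2.\<close>
  then have "t = 1"
    using one[of "\<not> s" t' t] eq by (simp add: insert_commute)
  show ?thesis
    using eq \<open>t = 1\<close> \<open>t' = 1\<close> by simp
qed

lemma card_dominating_ge_odd:
  assumes dom: "\<forall>x \<in> L - S. \<exists>y \<in> S. adj y x" and L: "L = insert None (blocks r {0, 1, 2, 3})"
    and "S \<subseteq> L"
  shows "2 * r + 1 \<le> card S"
proof (rule ccontr)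
  assume small: "\<not> ?thesis"
  have "finite S"
    using L \<open>S \<subseteq> L\<close> by (auto intro: finite_subset)
  have sub: "blocks r {0, 1, 2, 3} \<subseteq> L"
    using L by auto
  have ge: "2 * r \<le> card (S - {None})"
    using card_dominating_ge[OF dom sub _ \<open>finite S\<close>] by simp
  \<comment> \<open>The blocks already use \<open>2 * r\<close> vertices, so \<open>w\<close> would
    be one too many.\<close>
  have "None \<notin> S"
  proof
    assume "None \<in> S"
    then show False
      using card_Suc_Diff1[OF \<open>finite S\<close>, of None] ge small by simp
  qed
  have block2: "2 \<le> card (block S i)" if "i < r" for i
    using two_le_card_block[OF dom sub _ that \<open>finite S\<close>] by simp
  \<comment> \<open>A third vertex in a single block would push the total above
    \<open>2 * r\<close>.\<close>
  have two: "card (block S i) = 2" if "i < r" for i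
  proof (rule ccontr)
    assume "card (block S i) \<noteq> 2"
    then have "(\<Sum>i<r. 2) < (\<Sum>i<r. card (block S i))"
      using block2 that by (intro sum_strict_mono_ex1) (auto simp: order.strict_iff_order)
    then show False
      using sum_card_block_le[OF \<open>finite S\<close>, of r] small \<open>None \<notin> S\<close> by simp
  qed
  have index: "i < r" if "Some (i, s, t) \<in> S" for i s t
    using that \<open>S \<subseteq> L\<close> L by auto
  have pair: "block S i = {Some (i, s, 1), Some (i, \<not> s, 1)}" if "Some (i, s, t) \<in> S" "t < 2" for i s t
    using block_eq_kind_one_pair[OF dom sub \<open>finite S\<close> \<open>None \<notin> S\<close> _ _ that] index that two by blast
  \<comment> \<open>As \<open>w\<close> is not in \<open>S\<close>, it has a neighbour there, and
    this starts the analysis of one particular block.\<close>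
  obtain z where "z \<in> S" "adj z None"
    using dom \<open>None \<notin> S\<close> L by blast
  then obtain i s t where z: "Some (i, s, t) \<in> S" "t < 2"
    by (cases z) auto
  note bl = pair[OF z]
  have "Some (i, s, 0) \<notin> block S i"
    unfolding bl by simp
  then have "Some (i, s, 0) \<notin> S"
    by simp
  moreover have "Some (i, s, 0) \<in> L"
    using index[OF z(1)] L by simp
  ultimately obtain y where y: "y \<in> S" "adj y (Some (i, s, 0))"
    using dom by blast
  then obtain j s' t' where y': "y = Some (j, s', t')"
    using \<open>None \<notin> S\<close> by (cases y) auto
  have "t' = 0 \<or> j = i \<and> t' \<ge> 2"
    using y y' by (auto split: if_splits)
  moreover have "y \<in> block S j"
    using y y' by simp
  \<comment> \<open>If \<open>y\<close> were a hub, \<open>pair\<close> would make its block,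
    whichever it is, a kind 1 pair. The remaining option, kind at least 2 in block \<open>i\<close>,
    contradicts \<open>bl\<close>.\<close>
  moreover have "t' = 1" if "t' < 2"
    using pair[of j s' t'] y y' that calculation(2) by auto
  ultimately show False
    using bl y' by (cases "t' < 2") auto
qed

section \<open>The constructions for even and odd \<open>k\<close>\<close>

lemma D_graph_blocks_even:
  fixes T :: "nat set"
  assumes "r \<ge> 1" "finite T" "{2, 3} \<subseteq> T" "1 \<notin> T" "r = 1 \<or> 0 \<in> T" "2 * r * card T \<le> n"
  shows "\<exists>G :: nat pair_pre_digraph. D_graph (2 * r) G \<and> card (pverts G) = n"
proof -
  have "Some (0, False, 2) \<in> blocks r T"
    using assms(1,3) by auto
  then obtain f :: "nat \<Rightarrow> label" where f: "f ` {..<n} = blocks r T"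
    using exists_labelling[of "blocks r T" "Some (0, False, 2)" n] assms(2,6) by auto
  \<comment> \<open>With a single block, one vertex of kind 2 per side already forms the clique;
    with several blocks, only hubs are adjacent across blocks.\<close>
  define h where "h = (if r = 1 then 2 else 0 :: nat)"
  have hT: "h \<in> T"
    using assms(3,5) by (auto simp: h_def)
  define K where "K = (\<lambda>(i, s). Some (i, s, h)) ` ({..<r} \<times> (UNIV :: bool set))"
  \<comment> \<open>Every missing pair between opposite sides involves kind 1, which
    \<open>T\<close> excludes; hence each vertex dominates the opposite colour class.\<close>
  have opposite: "adj (Some (i, s, t)) (Some (i, \<not> s, t'))" if "t \<in> T" "t' \<in> T" for i s t t'
  proof -
    have "t \<noteq> 1" "t' \<noteq> 1"
      using that assms(4) by auto
    then show ?thesis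
      by auto
  qed
  have "D_graph (2 * r) (pullback {..<n} f adj)"
  proof (rule D_graph_pullback[where K = K and c = side], unfold f)
    show "card (side ` blocks r T) \<le> 2 * r"
      using card_mono[OF _ side_blocks[of r T]] card_sides[of r] by simp
    show "K \<subseteq> blocks r T"
      using hT by (auto simp: K_def)
    show "card K = 2 * r"
      unfolding K_def by (subst card_image) (auto simp: inj_on_def card_cartesian_product)
    show "adj x y" if "x \<in> K" "y \<in> K" "x \<noteq> y" for x y
      using that by (auto simp: K_def h_def split: if_splits)
    show "\<exists>y \<in> K. adj y x" if "x \<in> blocks r T" for x
    proof -
      obtain i s t where x: "x = Some (i, s, t)" "i < r" "t \<in> T"
        using \<open>x \<in> blocks r T\<close> by (auto simp: blocks_def)
      then show ?thesis
        using opposite[OF hT, of t i "\<not> s"] by (auto simp: K_def intro!: bexI[of _ "(i, \<not> s)"])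
    qed
    show "2 * r \<le> card S"
      if "S \<subseteq> blocks r T" "\<forall>x \<in> blocks r T - S. \<exists>y \<in> S. adj y x" for S
    proof -
      have "finite S" "None \<notin> S"
        using that(1) assms(2) by (auto intro: finite_subset)
      then show ?thesis
        using card_dominating_ge[OF that(2) order_refl assms(3)] by simp
    qed
    fix v assume "v \<in> {..<n}"
    then have "f v \<in> blocks r T"
      using f by blast
    then obtain i s t where v: "f v = Some (i, s, t)" "i < r" "t \<in> T"
      by (auto simp: blocks_def)
    have "adj (f v) (f w)" if w: "w < n" "side (f w) = Some (i, \<not> s)" for w
    proof -
      have "f w \<in> blocks r T"
        using w(1) f by blast
      then obtain t' where "f w = Some (i, \<not> s, t')" "t' \<in> T"
        using w(2) by (auto simp: blocks_def)
      then show ?thesis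
        using v opposite by simp
    qed
    moreover have "Some (i, \<not> s) \<in> side ` blocks r T"
      using v hT by (intro image_eqI[of _ _ "Some (i, \<not> s, h)"]) auto
    ultimately show "(\<exists>j \<in> side ` blocks r T. \<forall>w \<in> {..<n}. side (f w) = j \<longrightarrow> adj (f v) (f w)) \<or>
        (\<forall>w \<in> {..<n}. side (f w) = side (f v) \<longrightarrow> w = v)"
      by blast
  qed (use assms(1) in \<open>auto intro: adj_sym dest: adj_side\<close>)
  then show ?thesis
    by (intro exI[of _ "pullback {..<n} f adj"]) simp
qed

text \<open>Twins are made of a kind 2 vertex and not of \<open>w\<close>: since \<open>w\<close>
  misses part of every side, it can dominate only its own class, which must therefore stay a
  singleton.\<close>

lemma D_graph_blocks_odd:
  assumes "r \<ge> 1" "8 * r + 1 \<le> n"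
  shows "\<exists>G :: nat pair_pre_digraph. D_graph (2 * r + 1) G \<and> card (pverts G) = n"
proof -
  define L where "L = insert None (blocks r {0, 1, 2, 3})"
  have "finite L" "Some (0, False, 2) \<in> L" "card L \<le> n"
    using assms by (auto simp: L_def)
  then obtain f :: "nat \<Rightarrow> label" where f: "f ` {..<n} = L"
    and f_inj: "\<And>u v. f u = f v \<Longrightarrow> f u \<noteq> Some (0, False, 2) \<Longrightarrow> u = v"
    using exists_labelling by metis
  define K where "K = insert None ((\<lambda>(i, s). Some (i, s, 0 :: nat)) ` ({..<r} \<times> (UNIV :: bool set)))"
  have "D_graph (2 * r + 1) (pullback {..<n} f adj)"
  proof (rule D_graph_pullback[where K = K and c = side], unfold f)
    have "side ` L \<subseteq> insert None (Some ` ({..<r} \<times> UNIV))"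
      using side_blocks[of r] by (auto simp: L_def)
    then show "card (side ` L) \<le> 2 * r + 1"
      using card_mono[of "insert None (Some ` ({..<r} \<times> UNIV))" "side ` L"] card_sides[of r] by simp
    show "K \<subseteq> L"
      by (auto simp: K_def L_def)
    show "card K = 2 * r + 1"
      unfolding K_def
      by (subst card_insert_disjoint) (auto simp: card_image inj_on_def card_cartesian_product)
    show "adj x y" if "x \<in> K" "y \<in> K" "x \<noteq> y" for x y
      using that by (auto simp: K_def split: if_splits)
    show "\<exists>y \<in> K. adj y x" if xL: "x \<in> L" for x
    proof (cases x)
      case None
      have "Some (0, False, 0) \<in> K"
        using assms(1) by (auto simp: K_def)
      then show ?thesis
        using None by (intro bexI[of _ "Some (0, False, 0)"]) auto
    next
      case (Some a)
      then obtain i s t where x: "x = Some (i, s, t)" "i < r"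
        using xL by (cases a) (auto simp: L_def)
      have "None \<in> K" "Some (i, \<not> s, 0) \<in> K"
        using x by (auto simp: K_def)
      then show ?thesis
        using x by (cases "t < 2") (auto intro: bexI[of _ None] bexI[of _ "Some (i, \<not> s, 0)"])
    qed
    show "2 * r + 1 \<le> card S" if "S \<subseteq> L" "\<forall>x \<in> L - S. \<exists>y \<in> S. adj y x" for S
      using card_dominating_ge_odd[OF that(2) L_def that(1)] .
    fix v assume "v \<in> {..<n}"
    then have fv_L: "f v \<in> L"
      using f by blast
    show "(\<exists>j \<in> side ` L. \<forall>w \<in> {..<n}. side (f w) = j \<longrightarrow> adj (f v) (f w)) \<or>
        (\<forall>w \<in> {..<n}. side (f w) = side (f v) \<longrightarrow> w = v)"
    proof (cases "f v")
      case None
      have "w = v" if "side (f w) = side (f v)" for w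
      proof (rule f_inj)
        show "f w = f v"
          using that None by (simp add: side_def)
        then show "f w \<noteq> Some (0, False, 2)"
          using None by simp
      qed
      then show ?thesis
        by blast
    next
      case (Some a)
      then obtain i s t where fv: "f v = Some (i, s, t)" "i < r"
        using fv_L by (cases a) (auto simp: L_def)
      show ?thesis
      \<comment> \<open>Neighbours of \<open>w\<close> dominate the class of \<open>w\<close>; the
        other kinds are adjacent to the whole opposite side.\<close>
      proof (cases "t < 2")
        case True
        have "None \<in> side ` L"
          by (force simp: L_def)
        then show ?thesis
          using fv True by (intro disjI1 bexI[of _ None]) (auto simp: side_def)
      next
        case False
        have "Some (i, \<not> s) \<in> side ` L"
          using fv by (intro image_eqI[of _ _ "Some (i, \<not> s, 0)"]) (auto simp: L_def)
        then show ?thesis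
          using fv False by (intro disjI1 bexI[of _ "Some (i, \<not> s)"]) (auto simp: side_def)
      qed
    qed
  qed (auto intro: adj_sym dest: adj_side)
  then show ?thesis
    by (intro exI[of _ "pullback {..<n} f adj"]) simp
qed

theorem theorem2:
  fixes k n :: nat
  assumes "k \<ge> 2" and "n \<ge> 4 * k - 3"
  shows "\<exists>G :: nat pair_pre_digraph. D_graph k G \<and> card (pverts G) = n"
proof (cases "even k")
  case True
  then obtain r where r: "k = 2 * r"
    by blast
  show ?thesis
  \<comment> \<open>The label count is 4, below 5, for \<open>k = 2\<close>; otherwise it is
    \<open>3 * k\<close>, which is at most \<open>4 * k - 3\<close> since \<open>k\<close> is at
    least 4.\<close>
  proof (cases "r = 1")
    case True
    then show ?thesis
      using D_graph_blocks_even[of r "{2, 3}" n] assms r by simp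
  next
    case False
    then show ?thesis
      using D_graph_blocks_even[of r "{0, 2, 3}" n] assms r by simp
  qed
next
  case False
  then obtain r where "k = 2 * r + 1"
    by (rule oddE)
  \<comment> \<open>Here \<open>4 * k - 3\<close> equals \<open>8 * r + 1\<close>, exactly the
    number of labels.\<close>
  then show ?thesis
    using D_graph_blocks_odd[of r n] assms by simp
qed

end
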